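(* For any connected graph $H$, there is a connected graph $G$ such that $H$ is an induced subgraph of $G$ and $G$ is not proper conflict-free $(\mathrm{degree}+1)$-choosable.
   Context: All graphs are simple, finite and undirected. $d_G(v)$ denotes the degree of $v$ in $G$. Given a graph $G$ and a mapping $f:V(G)\to\mathbb{N}$, an $f$-list assignment of $G$ is a function $L$ that maps each $v\in V(G)$ to a set $L(v)$ of at least $f(v)$ colors. For an $f$-list assignment $L$, a proper conflict-free $L$-coloring of $G$ is a coloring $\phi$ of $V(G)$ such that (i) $\phi(v)\in L(v)$ for every $v\in V(G)$, (ii) $\phi$ is proper, i.e. adjacent vertices receive distinct colors, and (iii) for every non-isolated vertex $v\in V(G)$ there is a color that appears exactly once in the neighborhood of $v$ (i.e. is assigned to exactly one neighbor of $v$). $G$ is proper conflict-free $f$-choosable if for every $f$-list assignment $L$ of $G$ there exists a proper conflict-free $L$-coloring of $G$. For a non-negative integer $k$, $G$ is proper conflict-free $(\mathrm{degree}+k)$-choosable if $G$ is proper conflict-free $f$-choosable for the mapping $f(v)=d_G(v)+k$ for every $v\in V(G)$. *)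

theory Defs
  imports "Graph_Theory.Graph_Theory"
begin

(* Simple finite undirected graphs are the locale pair_graph: a finite vertex set with a symmetric
   irreflexive set of ordered pairs. Every edge uv is present as the two arcs (u,v) and (v,u), so
   out_degree is the usual degree. Library connectedness requires a nonempty vertex set. *)

definition nbhd :: "('a, 'b) pre_digraph \<Rightarrow> 'a \<Rightarrow> 'a set" where
  "nbhd G v = {u. v \<rightarrow>\<^bsub>G\<^esub> u}"

(* Infinite lists are allowed; they are treated separately because card is 0 on infinite sets. *)
definition list_assignment :: "('a, 'b) pre_digraph \<Rightarrow> ('a \<Rightarrow> nat) \<Rightarrow> ('a \<Rightarrow> 'c set) \<Rightarrow> bool" where
  "list_assignment G f L \<longleftrightarrow> (\<forall>v\<in>verts G. infinite (L v) \<or> f v \<le> card (L v))"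

definition pcf_coloring :: "('a, 'b) pre_digraph \<Rightarrow> ('a \<Rightarrow> 'c set) \<Rightarrow> ('a \<Rightarrow> 'c) \<Rightarrow> bool" where
  "pcf_coloring G L \<phi> \<longleftrightarrow>
     (\<forall>v\<in>verts G. \<phi> v \<in> L v) \<and>
     (\<forall>u v. u \<rightarrow>\<^bsub>G\<^esub> v \<longrightarrow> \<phi> u \<noteq> \<phi> v) \<and>
     (\<forall>v\<in>verts G. nbhd G v \<noteq> {} \<longrightarrow> (\<exists>c. \<exists>!u. u \<in> nbhd G v \<and> \<phi> u = c))"

(* Colors are natural numbers. For a finite graph this is no restriction: lists may be shrunk to
   finite sets, and then only finitely many colors occur. *)
definition pcf_choosable :: "('a, 'b) pre_digraph \<Rightarrow> ('a \<Rightarrow> nat) \<Rightarrow> bool" where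
  "pcf_choosable G f \<longleftrightarrow>
     (\<forall>L :: 'a \<Rightarrow> nat set. list_assignment G f L \<longrightarrow> (\<exists>\<phi>. pcf_coloring G L \<phi>))"

definition pcf_degree_choosable :: "('a, 'b) pre_digraph \<Rightarrow> nat \<Rightarrow> bool" where
  "pcf_degree_choosable G k \<longleftrightarrow> pcf_choosable G (\<lambda>v. out_degree G v + k)"

end

theory Submission
  imports Defs
begin

text \<open>A square \<open>v a b c\<close> whose vertices \<open>a, b, c\<close> have degree 2 and the same list of three colors
  forces all four colors to be distinct: the two neighbors of each of \<open>a, b\<close> must differ in color. So it
  excludes all three colors at \<open>v\<close>, while it raises the degree of \<open>v\<close> by 2 only. With \<open>d + 1\<close> squares
  on disjoint lists at a vertex of degree \<open>d\<close>, the new degree is \<open>3 d + 2\<close>, and a list of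
  \<open>3 d + 3\<close> colors can be excluded completely at that vertex.\<close>

text \<open>The vertex type of \<open>H\<close> may be finite and so leave no room for a larger
  graph. Over the natural numbers, with vertex set \<open>{..<n}\<close>, all numbers from
  \<open>n\<close> on are fresh.\<close>

lemma pair_graph_iso_nat:
  fixes H :: "'a pair_pre_digraph"
  assumes "pair_graph H"
  obtains K :: "nat pair_pre_digraph" and n
  where "pair_graph K" "pverts K = {..<n}" "digraph_iso (with_proj H) (with_proj K)"
    "connected H \<Longrightarrow> connected K"
proof -
  interpret H: pair_graph H by fact
  obtain h :: "'a \<Rightarrow> nat" and n where h: "h ` pverts H = {i. i < n}" "inj_on h (pverts H)"
    using finite_imp_inj_to_nat_seg[OF H.pair_finite_verts] by auto
  define K where "K = \<lparr>pverts = h ` pverts H, parcs = map_prod h h ` parcs H\<rparr>"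
  have "symmetric H" by (rule H.pair_sym_arcs)
  then have sym: "(y, x) \<in> parcs H" if "(x, y) \<in> parcs H" for x y
    using that by (auto simp: symmetric_def dest: symD)
  have K: "pair_graph K"
  proof
    show "fst e \<in> pverts K" "snd e \<in> pverts K" if "e \<in> parcs K" for e
      using that by (auto simp: K_def dest: H.in_arcsD1 H.in_arcsD2)
    show "finite (pverts K)" "finite (parcs K)"
      by (auto simp: K_def H.pair_finite_verts H.pair_finite_arcs)
    show "fst e \<noteq> snd e" if "e \<in> parcs K" for e
      using that H.no_loops'
      by (force simp: K_def dest: inj_onD[OF h(2)] H.in_arcsD1 H.in_arcsD2)
    show "symmetric (with_proj K)"
      by (force simp: K_def symmetric_def sym_def dest: sym)
  qed
  \<comment> \<open>Arcs are pairs of vertices, so the arc map is forced by \<open>h\<close>. The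
    projections \<open>fst\<close> and \<open>snd\<close> as new tail and head make the image
    exactly \<open>with_proj K\<close>.\<close>
  define f where "f = \<lparr>iso_verts = h, iso_arcs = map_prod h h, iso_head = snd, iso_tail = fst\<rparr>"
  have f: "H.digraph_isomorphism f"
    unfolding H.digraph_isomorphism_def
    by (auto simp: f_def h H.wf_digraph_axioms
        intro!: inj_on_subset[OF map_prod_inj_on[OF h(2) h(2)]] dest: H.in_arcsD1 H.in_arcsD2)
  have fK: "with_proj K = app_iso f H"
    by (auto simp: app_iso_def f_def K_def with_proj_def)
  show thesis
  proof
    show "pair_graph K" by (rule K)
    show "pverts K = {..<n}" using h by (auto simp: K_def)
    show "digraph_iso (with_proj H) (with_proj K)"
      using f fK by (auto simp: digraph_iso_def)
    show "connected K" if "connected H"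
      unfolding fK using that f by (rule H.connectedI_app_iso)
  qed
qed

lemma out_degree_nbhd: "out_degree (with_proj G) w = card (nbhd (with_proj G) w)"
proof -
  have "out_arcs (with_proj G) w = Pair w ` nbhd (with_proj G) w"
    by (auto simp: out_arcs_def nbhd_def)
  then show ?thesis
    by (simp add: out_degree_def card_image inj_on_def)
qed

text \<open>If both neighbors had the same color, it would be the only color around \<open>w\<close>
  and would appear twice, leaving no color that appears exactly once.\<close>

lemma pcf_coloring_degree_2:
  assumes "pcf_coloring G L \<phi>" "w \<in> verts G" "nbhd G w = {x, y}" "x \<noteq> y"
  shows "\<phi> x \<noteq> \<phi> y"
proof
  assume same: "\<phi> x = \<phi> y"
  have "\<forall>v\<in>verts G. nbhd G v \<noteq> {} \<longrightarrow> (\<exists>c. \<exists>!u. u \<in> nbhd G v \<and> \<phi> u = c)"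
    using assms(1) unfolding pcf_coloring_def by (elim conjE)
  then have "\<exists>c. \<exists>!u. u \<in> nbhd G w \<and> \<phi> u = c"
    by (rule bspec[OF _ assms(2), THEN mp]) (simp add: assms(3))
  then obtain c where c: "\<exists>!u. u \<in> {x, y} \<and> \<phi> u = c"
    unfolding assms(3) by (elim exE)
  then obtain u where "u \<in> {x, y} \<and> \<phi> u = c" by (elim ex1E)
  then have "\<phi> x = c" "\<phi> y = c" using same by auto
  then have "x \<in> {x, y} \<and> \<phi> x = c" "y \<in> {x, y} \<and> \<phi> y = c" by simp_all
  with c have "x = y" by metis
  with assms(4) show False by simp
qed

text \<open>Each square is listed in one direction of rotation; \<open>attach_squares\<close> adds
  the converse. The numbering lets division by 3 recover the index of a square from its
  vertices.\<close>

definition square_arcs :: "nat \<Rightarrow> nat \<Rightarrow> nat \<Rightarrow> nat rel" where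
  "square_arcs v n k =
     (\<Union>i<k. {(v, n + 3 * i), (n + 3 * i, n + 3 * i + 1),
              (n + 3 * i + 1, n + 3 * i + 2), (n + 3 * i + 2, v)})"

definition attach_squares :: "nat pair_pre_digraph \<Rightarrow> nat \<Rightarrow> nat \<Rightarrow> nat \<Rightarrow> nat pair_pre_digraph" where
  "attach_squares K v n k =
     \<lparr>pverts = pverts K \<union> {n..<n + 3 * k},
      parcs = parcs K \<union> square_arcs v n k \<union> (square_arcs v n k)\<inverse>\<rparr>"

locale squares_attached = pair_graph K for K :: "nat pair_pre_digraph" +
  fixes v n k :: nat
  assumes verts_K: "pverts K = {..<n}" and v_in: "v \<in> pverts K"
begin

abbreviation "G \<equiv> attach_squares K v n k"

lemma v_less: "v < n"
  using v_in verts_K by auto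

lemma arcs_K_less: "(x, y) \<in> parcs K \<Longrightarrow> x < n \<and> y < n"
  using in_arcsD1 in_arcsD2 verts_K by auto

lemma pair_graph_G: "pair_graph G"
proof
  show "fst e \<in> pverts G" "snd e \<in> pverts G" if "e \<in> parcs G" for e
    using that v_in
    by (auto simp: attach_squares_def square_arcs_def dest: in_arcsD1 in_arcsD2)
  show "finite (pverts G)"
    by (simp add: attach_squares_def pair_finite_verts)
  show "finite (parcs G)"
    by (simp add: attach_squares_def square_arcs_def pair_finite_arcs)
  show "fst e \<noteq> snd e" if "e \<in> parcs G" for e
    using that v_less pair_no_loops by (auto simp: attach_squares_def square_arcs_def)
  show "symmetric (with_proj G)"
    using pair_sym_arcs by (auto simp: symmetric_def sym_def attach_squares_def)
qed

text \<open>Every arc of a square has an endpoint that is at least \<open>n\<close>, so no arc is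
  added between vertices of \<open>K\<close>.\<close>

lemma induced_K: "induced_subgraph (with_proj K) (with_proj G)"
proof -
  interpret G: pair_graph G by (rule pair_graph_G)
  show ?thesis
    using v_in G.wf_digraph_axioms
    by (auto simp: induced_subgraph_def subgraph_def wf_digraph_axioms attach_squares_def
        square_arcs_def verts_K dest: arcs_K_less)
qed

lemma square_arcs_in_G:
  assumes "i < k"
  shows "(v, n + 3 * i) \<in> parcs G" "(n + 3 * i, n + 3 * i + 1) \<in> parcs G"
    "(n + 3 * i + 1, n + 3 * i + 2) \<in> parcs G" "(v, n + 3 * i + 2) \<in> parcs G"
  using assms by (auto simp: attach_squares_def square_arcs_def)

lemma square_vertex_cases:
  assumes "w \<in> {n..<n + 3 * k}"
  obtains i where "i < k" "w = n + 3 * i \<or> w = n + 3 * i + 1 \<or> w = n + 3 * i + 2"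
proof (rule that)
  have w: "n \<le> w" "w - n < 3 * k" using assms by auto
  then show "(w - n) div 3 < k" by (simp add: less_mult_imp_div_less mult.commute)
  have "(w - n) mod 3 = 0 \<or> (w - n) mod 3 = 1 \<or> (w - n) mod 3 = 2" by linarith
  moreover have "w = n + 3 * ((w - n) div 3) + (w - n) mod 3" using w(1) by simp
  ultimately show "w = n + 3 * ((w - n) div 3) \<or> w = n + 3 * ((w - n) div 3) + 1 \<or>
      w = n + 3 * ((w - n) div 3) + 2"
    by linarith
qed

text \<open>Every vertex is reachable from \<open>v\<close>, within \<open>K\<close> or along a
  square, and symmetry of the arcs allows going back to \<open>v\<close>.\<close>

lemma connected_G:
  assumes "connected K"
  shows "connected G"
proof -
  interpret G: pair_graph G by (rule pair_graph_G)
  have reach: "v \<rightarrow>\<^sup>*\<^bsub>G\<^esub> w" if w: "w \<in> pverts G" for w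
  proof (cases "w \<in> pverts K")
    case True
    have "v \<rightarrow>\<^sup>*\<^bsub>K\<^esub> w"
      using symmetric_connected_imp_strongly_connected[OF pair_sym_arcs assms] True v_in
      by (auto simp: strongly_connected_def)
    moreover have "subgraph (with_proj K) (with_proj G)"
      using induced_K by (simp add: induced_subgraph_def)
    ultimately show ?thesis by (rule G.reachable_mono)
  next
    case False
    then have "w \<in> {n..<n + 3 * k}" using w by (auto simp: attach_squares_def)
    then obtain i where i: "i < k" "w = n + 3 * i \<or> w = n + 3 * i + 1 \<or> w = n + 3 * i + 2"
      by (rule square_vertex_cases)
    note reach = square_arcs_in_G[OF i(1), THEN G.reachable_adjI]
    show ?thesis
      using i(2) reach(1,4) G.reachable_trans[OF reach(1,2)] by (elim disjE) simp_all
  qed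
  have "u \<rightarrow>\<^sup>*\<^bsub>G\<^esub> w" if "u \<in> pverts G" "w \<in> pverts G" for u w
    using symmetric_reachable[OF G.pair_sym_arcs reach[OF that(1)]] reach[OF that(2)]
    by (rule G.reachable_trans)
  moreover have "pverts G \<noteq> {}" using v_in by (auto simp: attach_squares_def)
  ultimately show ?thesis
    by (intro G.connectedI) (auto simp: G.reachable_mk_symmetric_eq G.pair_sym_arcs)
qed

lemma nbhd_square:
  assumes "i < k"
  shows "nbhd G (n + 3 * i) = {v, n + 3 * i + 1}"
    "nbhd G (n + 3 * i + 1) = {n + 3 * i, n + 3 * i + 2}"
    "nbhd G (n + 3 * i + 2) = {n + 3 * i + 1, v}"
proof -
  \<comment> \<open>The three positions in a square are distinct residues modulo 3, which separates
    each vertex from those at other positions in any square.\<close>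
  have mod3: "3 * a \<noteq> Suc (3 * b)" "Suc (3 * b) \<noteq> 3 * a"
    "3 * a \<noteq> Suc (Suc (3 * b))" "Suc (Suc (3 * b)) \<noteq> 3 * a" for a b :: nat
    by presburger+
  show "nbhd G (n + 3 * i) = {v, n + 3 * i + 1}"
    "nbhd G (n + 3 * i + 1) = {n + 3 * i, n + 3 * i + 2}"
    "nbhd G (n + 3 * i + 2) = {n + 3 * i + 1, v}"
    using assms v_less
    by (auto simp: nbhd_def attach_squares_def square_arcs_def mod3 dest: arcs_K_less)
qed

text \<open>Each square adds only its first and third new vertex to the neighborhood of
  \<open>v\<close>. The upper bound is the direction that certifies a list at \<open>v\<close> as
  long enough.\<close>

lemma out_degree_v_le: "out_degree G v \<le> out_degree K v + 2 * k"
proof -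
  let ?A = "(\<lambda>i. n + 3 * i) ` {..<k}" and ?B = "(\<lambda>i. n + 3 * i + 2) ` {..<k}"
  have K_fin: "finite (nbhd K v)"
    by (rule finite_subset[OF _ pair_finite_verts]) (auto simp: nbhd_def dest: in_arcsD2)
  have "nbhd G v \<subseteq> nbhd K v \<union> (?A \<union> ?B)"
    using v_less by (auto simp: nbhd_def attach_squares_def square_arcs_def)
  then have "card (nbhd G v) \<le> card (nbhd K v \<union> (?A \<union> ?B))"
    using K_fin by (intro card_mono) auto
  also have "\<dots> \<le> card (nbhd K v) + (card ?A + card ?B)"
    by (intro order_trans[OF card_Un_le] add_left_mono card_Un_le)
  also have "card ?A + card ?B \<le> 2 * k"
    using card_image_le[of "{..<k}" "\<lambda>i. n + 3 * i"] card_image_le[of "{..<k}" "\<lambda>i. n + 3 * i + 2"]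
    by simp
  finally show ?thesis by (simp add: out_degree_nbhd)
qed

lemma square_excludes_colors:
  assumes "i < k" "pcf_coloring G L \<phi>"
    and L: "\<And>j. j < 3 \<Longrightarrow> L (n + 3 * i + j) = {3 * i..<3 * i + 3}"
  shows "\<phi> v \<notin> {3 * i..<3 * i + 3}"
proof
  assume v: "\<phi> v \<in> {3 * i..<3 * i + 3}"
  let ?a = "n + 3 * i" and ?b = "n + 3 * i + 1" and ?c = "n + 3 * i + 2"
  have proper: "\<phi> x \<noteq> \<phi> y" if "(x, y) \<in> parcs G" for x y
    using assms(2) that by (auto simp: pcf_coloring_def)
  have in_list: "\<phi> x \<in> L x" if "x \<in> pverts G" for x
    using assms(2) that by (auto simp: pcf_coloring_def)
  have verts: "?a \<in> pverts G" "?b \<in> pverts G" "?c \<in> pverts G"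
    using assms(1) by (auto simp: attach_squares_def)
  note pcf_coloring_degree_2[OF assms(2)]
  \<comment> \<open>The two diagonals of the square: the neighbors of \<open>?a\<close> are
    \<open>v\<close> and \<open>?b\<close>, those of \<open>?b\<close> are \<open>?a\<close> and
    \<open>?c\<close>. The four sides follow from properness.\<close>
  from this[of ?a, OF _ nbhd_square(1)] this[of ?b, OF _ nbhd_square(2)]
  have "\<phi> v \<noteq> \<phi> ?b" "\<phi> ?a \<noteq> \<phi> ?c"
    using assms(1) verts v_less by simp_all
  moreover have "\<phi> v \<noteq> \<phi> ?a" "\<phi> ?a \<noteq> \<phi> ?b" "\<phi> ?b \<noteq> \<phi> ?c" "\<phi> v \<noteq> \<phi> ?c"
    by (intro proper square_arcs_in_G[OF assms(1)])+
  moreover have "\<phi> ?a \<in> {3 * i..<3 * i + 3}" "\<phi> ?b \<in> {3 * i..<3 * i + 3}"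
    "\<phi> ?c \<in> {3 * i..<3 * i + 3}"
    using verts[THEN in_list] L[of 0] L[of 1] L[of 2]
    by (simp_all del: atLeastLessThan_iff add_2_eq_Suc')
  \<comment> \<open>Four pairwise distinct numbers would lie in an interval of three.\<close>
  ultimately show False using v unfolding atLeastLessThan_iff by linarith
qed

lemma not_choosable_G:
  assumes "out_degree K v < k"
  shows "\<not> pcf_degree_choosable G 1"
proof
  assume choosable: "pcf_degree_choosable G 1"
  \<comment> \<open>The list at \<open>v\<close> is cut into \<open>k\<close> blocks of three
    colors, and block \<open>i\<close> is the list on square \<open>i\<close>. The infinite list
    \<open>UNIV\<close> on the rest of \<open>K\<close> is admissible whatever the degrees
    are.\<close>
  define L :: "nat \<Rightarrow> nat set" where
    "L w = (if w = v then {..<3 * k}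
            else if w < n then UNIV
            else let i = (w - n) div 3 in {3 * i..<3 * i + 3})" for w
  have L_square: "L (n + 3 * i + j) = {3 * i..<3 * i + 3}" if "j < 3" for i j
  proof -
    have "(3 * i + j) div 3 = i" using that by simp
    then show ?thesis using v_less by (simp add: L_def)
  qed
  have "infinite (L w) \<or> out_degree G w + 1 \<le> card (L w)" if "w \<in> pverts G" for w
  proof (cases "w < n")
    case True
    \<comment> \<open>At \<open>w = v\<close>, with \<open>d = out_degree K v < k\<close>, the bound
      is \<open>d + 2 * k + 1 \<le> 3 * k\<close>, the size of the list.\<close>
    then show ?thesis using out_degree_v_le assms by (auto simp: L_def)
  next
    case False
    then have "w \<in> {n..<n + 3 * k}"
      using that by (auto simp: attach_squares_def verts_K)
    then obtain i where i: "i < k" "w = n + 3 * i \<or> w = n + 3 * i + 1 \<or> w = n + 3 * i + 2"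
      by (rule square_vertex_cases)
    have "card (nbhd G w) \<le> 2"
      using i nbhd_square[OF i(1)] by (auto simp: card_insert_if)
    moreover have "card (L w) = 3"
      using i(2) L_square[of 0 i] L_square[of 1 i] L_square[of 2 i] by auto
    ultimately show ?thesis by (simp add: out_degree_nbhd)
  qed
  then have "list_assignment G (\<lambda>w. out_degree G w + 1) L"
    by (simp add: list_assignment_def)
  then obtain \<phi> where \<phi>: "pcf_coloring G L \<phi>"
    using choosable unfolding pcf_degree_choosable_def pcf_choosable_def by blast
  have "v \<in> pverts G" using v_in by (simp add: attach_squares_def)
  then have "\<phi> v \<in> L v" using \<phi> by (simp add: pcf_coloring_def)
  \<comment> \<open>The quotient \<open>\<phi> v div 3\<close> is the index of the block containing
    the color of \<open>v\<close>; the square with that index excludes this color.\<close>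
  then have "\<phi> v div 3 < k" by (simp add: L_def less_mult_imp_div_less mult.commute)
  from square_excludes_colors[OF this \<phi> L_square]
  show False by simp
qed

end

theorem theorem5:
  fixes H :: "'a pair_pre_digraph"
  assumes "pair_graph H" and "connected H"
  shows "\<exists>G :: nat pair_pre_digraph. pair_graph G \<and> connected G \<and>
    (\<exists>H'. induced_subgraph H' (with_proj G) \<and> digraph_iso (with_proj H) H') \<and>
    \<not> pcf_degree_choosable G 1"
proof -
  obtain K :: "nat pair_pre_digraph" and n
    where K: "pair_graph K" "pverts K = {..<n}" "digraph_iso (with_proj H) (with_proj K)"
      "connected K"
    using pair_graph_iso_nat[OF assms(1)] assms(2) by metis
  \<comment> \<open>Connectedness includes nonemptiness, and any vertex can carry the
    squares.\<close>
  obtain v where v: "v \<in> pverts K"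
    using K(4) by (auto simp: connected_def strongly_connected_def)
  \<comment> \<open>This is the smallest number of squares allowed by
    \<open>not_choosable_G\<close>.\<close>
  interpret squares_attached K v n "out_degree K v + 1"
    using K v by (simp add: squares_attached_def squares_attached_axioms_def)
  show ?thesis
  proof (intro exI conjI)
    show "pair_graph G" by (rule pair_graph_G)
    show "connected G" by (rule connected_G[OF K(4)])
    show "induced_subgraph (with_proj K) (with_proj G)" by (rule induced_K)
    show "digraph_iso (with_proj H) (with_proj K)" by (rule K(3))
    show "\<not> pcf_degree_choosable G 1" by (rule not_choosable_G) simp
  qed
qed

end
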